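(* Suppose $f:\mathbb{T}^2\to\mathbb{T}^2$ is a homeomorphism homotopic to the identity with lift $F\in\mathcal{H}_2$, and $\delta,\gamma\in(0,\frac12)$ are such that $d(x,y)<\delta$ implies $d(f(x),f(y))<\frac12-\gamma$ for all $x,y\in\mathbb{T}^2$. Further, assume that $f$ has the $\delta$-shadowing property with constant $\epsilon\in(0,\gamma)$. Then $\varrho^{\epsilon}(F)=\varrho(F)$.
   Context: $\mathbb{T}^2=\mathbb{R}^2/\mathbb{Z}^2$ with the metric $d$ induced by the Euclidean metric of $\mathbb{R}^2$. $\mathcal{H}_2$ is the set of all lifts $F:\mathbb{R}^2\to\mathbb{R}^2$ of homeomorphisms of $\mathbb{T}^2$ homotopic to the identity. Pseudo-orbits: for a self-map $g$ of a metric space $(X,d)$ and $\epsilon\ge0$, a finite tuple $(\xi_j)_{j=0}^n$ (of length $n+1$) or infinite sequence $(\xi_j)_{j\ge0}$ in $X$ is an $\epsilon$-pseudo-orbit of $g$ if $d(g(\xi_j),\xi_{j+1})\le\epsilon$ for all $j\in\{0,\ldots,n-1\}$, respectively all $j\ge0$. Shadowing: an orbit $(x_n)_{n\ge0}$ of $g$ (i.e. $x_{n}=g^n(x_0)$) $\delta$-shadows a sequence $(\xi_n)_{n\ge0}$ if $d(x_n,\xi_n)<\delta$ for all $n\ge0$. $g$ has the $\delta$-shadowing property with constant $\epsilon$ if every $\epsilon$-pseudo-orbit of $g$ is $\delta$-shadowed by some orbit of $g$. Rotation set: $\varrho(F)$ is the set of all $v\in\mathbb{R}^2$ for which there exist integers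 $n_i\nearrow\infty$ and points $x_i\in\mathbb{R}^2$ with $\lim_{i\to\infty}\frac{F^{n_i}(x_i)-x_i}{n_i}=v$. $\epsilon$-rotation set: $\varrho^{\epsilon}(F)$ is the set of all accumulation points of sequences $\left(\frac{\xi^i_{n_i}-\xi^i_0}{n_i}\right)_{i\in\mathbb{N}}$, where $n_i\to\infty$ and $(\xi^i_j)_{j=0}^{n_i}$ is an $\epsilon$-pseudo-orbit of $F$ (in $\mathbb{R}^2$ with the Euclidean metric) of length $n_i+1$ for each $i$. *)

theory Defs
  imports "HOL-Analysis.Analysis"
begin

definition lattice_rel :: "real^2 \<Rightarrow> real^2 \<Rightarrow> bool" where
  "lattice_rel x y \<longleftrightarrow> (\<forall>i. (x - y) $ i \<in> \<int>)"

lemma equivp_lattice_rel: "equivp lattice_rel"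
proof (rule equivpI)
  show "reflp lattice_rel"
    by (simp add: reflp_def lattice_rel_def)
  show "symp lattice_rel"
  proof (rule sympI)
    fix x y :: "real^2"
    assume "lattice_rel x y"
    then have "- ((x - y) $ i) \<in> \<int>" for i
      unfolding lattice_rel_def by (blast intro: Ints_minus)
    then show "lattice_rel y x"
      by (simp add: lattice_rel_def)
  qed
  show "transp lattice_rel"
  proof (rule transpI)
    fix x y z :: "real^2"
    assume "lattice_rel x y" "lattice_rel y z"
    then have "(x - y) $ i + (y - z) $ i \<in> \<int>" for i
      unfolding lattice_rel_def by (blast intro: Ints_add)
    then show "lattice_rel x z"
      by (simp add: lattice_rel_def)
  qed
qed

quotient_type torus = "real^2" / lattice_rel
  by (rule equivp_lattice_rel)

abbreviation proj :: "real^2 \<Rightarrow> torus" where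
  "proj \<equiv> abs_torus"

lemma proj_eq_iff: "proj x = proj y \<longleftrightarrow> lattice_rel x y"
  by (rule torus.abs_eq_iff)

lemma proj_surj: "\<exists>x. proj x = t"
  by (metis Quotient3_abs_rep Quotient3_torus)

lemma proj_translate:
  assumes "proj a = proj b"
  shows "proj (c + (b - a)) = proj c"
proof -
  have "- ((a - b) $ i) \<in> \<int>" for i
    using assms unfolding proj_eq_iff lattice_rel_def by (blast intro: Ints_minus)
  then show ?thesis
    unfolding proj_eq_iff lattice_rel_def by simp
qed

instantiation torus :: metric_space
begin

definition dist_torus :: "torus \<Rightarrow> torus \<Rightarrow> real" where
  "dist_torus s t = Inf {dist x y |x y. proj x = s \<and> proj y = t}"

definition uniformity_torus :: "(torus \<times> torus) filter" where
  "uniformity_torus = (INF e\<in>{0<..}. principal {(s, t). dist s t < e})"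

definition open_torus :: "torus set \<Rightarrow> bool" where
  "open_torus U \<longleftrightarrow> (\<forall>s\<in>U. eventually (\<lambda>(s', t). s' = s \<longrightarrow> t \<in> U) uniformity)"

lemma torus_dist_bdd: "bdd_below {dist x y |x y. proj x = s \<and> proj y = t}"
proof (rule bdd_belowI)
  fix d assume "d \<in> {dist x y |x y. proj x = s \<and> proj y = t}"
  then obtain x y :: "real^2" where "d = dist x y" by blast
  then show "0 \<le> d" by (simp only: zero_le_dist)
qed

lemma torus_dist_ne: "{dist x y |x y. proj x = s \<and> proj y = t} \<noteq> {}"
proof -
  obtain x y where "proj x = s" "proj y = t"
    using proj_surj[of s] proj_surj[of t] by (elim exE)
  then have "dist x y \<in> {dist x y |x y. proj x = s \<and> proj y = t}" by blast
  then show ?thesis by force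
qed

lemma torus_dist_le: "dist (proj x) (proj y) \<le> dist x y"
  unfolding dist_torus_def by (rule cInf_lower[OF _ torus_dist_bdd]) blast

lemma torus_dist_lessD:
  assumes "dist s t < e" "proj a = s"
  obtains b where "proj b = t" "dist a b < e"
proof -
  obtain x y where xy: "proj x = s" "proj y = t" "dist x y < e"
    using cInf_lessD[OF torus_dist_ne assms(1)[unfolded dist_torus_def]] by blast
  have "proj (y + (a - x)) = t"
    using proj_translate[of x a y] xy assms(2) by simp
  moreover have "dist a (y + (a - x)) < e"
  proof -
    have "a - (y + (a - x)) = x - y" by simp
    then show ?thesis using xy(3) unfolding dist_norm by (simp only:)
  qed
  ultimately show thesis by (rule that)
qed

lemma torus_dist_sym: "dist s t = dist t (s::torus)"
proof -
  have "{dist x y |x y. proj x = s \<and> proj y = t} \<subseteq> {dist x y |x y. proj x = t \<and> proj y = s}"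
    for s t
  proof clarify
    fix x y :: "real^2"
    show "\<exists>x' y'. dist x y = dist x' y' \<and> proj x' = proj y \<and> proj y' = proj x"
      by (rule exI[of _ y], rule exI[of _ x]) (simp add: dist_commute)
  qed
  then show ?thesis
    unfolding dist_torus_def by (intro arg_cong[of _ _ Inf] equalityI)
qed

lemma torus_dist_ge0: "0 \<le> dist (s::torus) t"
  unfolding dist_torus_def
proof (rule cInf_greatest)
  show "{dist x y |x y. proj x = s \<and> proj y = t} \<noteq> {}"
    by (rule torus_dist_ne)
  fix d assume "d \<in> {dist x y |x y. proj x = s \<and> proj y = t}"
  then obtain x y :: "real^2" where "d = dist x y" by blast
  then show "0 \<le> d" by (simp only: zero_le_dist)
qed

instance
proof
  show "uniformity = (INF e\<in>{0<..}. principal {(s::torus, t). dist s t < e})"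
    by (rule uniformity_torus_def)
  show "open U \<longleftrightarrow> (\<forall>s\<in>U. eventually (\<lambda>(s', t). s' = s \<longrightarrow> t \<in> U) uniformity)"
    for U :: "torus set"
    by (rule open_torus_def)
  show "dist s t = 0 \<longleftrightarrow> s = t" for s t :: torus
  proof
    assume d0: "dist s t = 0"
    obtain a where a: "proj a = s" using proj_surj[of s] by (elim exE)
    have ex: "\<exists>b. proj b = t \<and> dist a b < e" if "e > 0" for e
    proof -
      have "dist s t < e" using d0 that by simp
      then show ?thesis by (rule torus_dist_lessD[OF _ a]) blast
    qed
    then obtain b where b: "proj b = t" "dist a b < 1/2"
      using ex[of "1/2"] by auto
    have "dist a b < e" if "e > 0" for e
    proof -
      obtain c where c: "proj c = t" "dist a c < min e (1/2)"
        using ex[of "min e (1/2)"] \<open>e > 0\<close> by auto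
      have "(b - c) $ i = 0" for i
      proof -
        have "(b - c) $ i \<in> \<int>"
          using b(1) c(1) proj_eq_iff lattice_rel_def by metis
        moreover have "\<bar>(b - c) $ i\<bar> < 1"
        proof -
          have "\<bar>(b - c) $ i\<bar> \<le> dist b c"
            by (metis component_le_norm_cart dist_norm)
          also have "\<dots> \<le> dist a b + dist a c"
            by (rule dist_triangle3)
          finally show ?thesis using b(2) c(2) by simp
        qed
        ultimately show ?thesis by (rule Ints_nonzero_abs_less1)
      qed
      then have "b = c" by (simp add: vec_eq_iff)
      with c(2) show ?thesis by simp
    qed
    then have "a = b"
      using zero_less_dist_iff[of a b] by blast
    with a b(1) show "s = t" by simp
  next
    assume "s = t"
    moreover obtain a where "proj a = s" using proj_surj[of s] by (elim exE)
    ultimately have "dist s t \<le> 0" using torus_dist_le[of a a] by simp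
    then show "dist s t = 0" using torus_dist_ge0[of s t] by simp
  qed
  show "dist s t \<le> dist s u + dist t u" for s t u :: torus
  proof (rule field_le_epsilon)
    fix e :: real assume "e > 0"
    obtain c where c: "proj c = u" using proj_surj[of u] by (elim exE)
    have "dist u s < dist s u + e/2" "dist u t < dist t u + e/2"
      using \<open>e > 0\<close> torus_dist_sym[of u s] torus_dist_sym[of u t] by simp_all
    note less = this
    obtain a where a: "proj a = s" "dist c a < dist s u + e/2"
      by (rule torus_dist_lessD[OF less(1) c])
    obtain b where b: "proj b = t" "dist c b < dist t u + e/2"
      by (rule torus_dist_lessD[OF less(2) c])
    have "dist s t \<le> dist a b" using torus_dist_le[of a b] a b by simp
    also have "\<dots> \<le> dist c a + dist c b" by (rule dist_triangle3)
    also have "\<dots> \<le> dist s u + dist t u + e" using a(2) b(2) by simp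
    finally show "dist s t \<le> dist s u + dist t u + e" .
  qed
qed

end

text \<open>The metric topology on the torus is the quotient topology.\<close>

lemma open_torus_iff: "open U \<longleftrightarrow> open (proj -` U)"
proof
  have "continuous_on UNIV proj"
    unfolding continuous_on_iff by (meson torus_dist_le le_less_trans)
  then show "open (proj -` U)" if "open U"
    using that by (simp add: continuous_on_open_vimage)
next
  assume o: "open (proj -` U)"
  show "open U"
    unfolding open_dist
  proof
    fix s assume "s \<in> U"
    obtain a where a: "proj a = s" using proj_surj[of s] by (elim exE)
    then obtain e where e: "e > 0" "\<And>b. dist b a < e \<Longrightarrow> proj b \<in> U"
      using o \<open>s \<in> U\<close> unfolding open_dist by auto
    have "t \<in> U" if "dist t s < e" for t
    proof -
      have "dist s t < e" using that by (simp add: dist_commute)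
      then obtain b where "proj b = t" "dist a b < e" by (rule torus_dist_lessD[OF _ a])
      then show ?thesis using e(2)[of b] by (auto simp: dist_commute)
    qed
    with e(1) show "\<exists>e>0. \<forall>t. dist t s < e \<longrightarrow> t \<in> U" by blast
  qed
qed

definition homeo_homotopic_id :: "(torus \<Rightarrow> torus) \<Rightarrow> bool" where
  "homeo_homotopic_id f \<longleftrightarrow>
     (\<exists>g. homeomorphism UNIV UNIV f g) \<and>
     homotopic_with_canon (\<lambda>_. True) UNIV UNIV f id"

definition is_lift :: "(real^2 \<Rightarrow> real^2) \<Rightarrow> (torus \<Rightarrow> torus) \<Rightarrow> bool" where
  "is_lift F f \<longleftrightarrow> continuous_on UNIV F \<and> proj \<circ> F = f \<circ> proj"

definition H2 :: "(real^2 \<Rightarrow> real^2) set" where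
  "H2 = {F. \<exists>f. homeo_homotopic_id f \<and> is_lift F f}"

text \<open>A finite tuple of length \<open>n + 1\<close> is given by the values at \<open>0, \<dots>, n\<close> of a function on
  \<^typ>\<open>nat\<close>; the values beyond \<open>n\<close> are not used.\<close>

definition fin_pseudo_orbit ::
    "real \<Rightarrow> ('a::metric_space \<Rightarrow> 'a) \<Rightarrow> nat \<Rightarrow> (nat \<Rightarrow> 'a) \<Rightarrow> bool" where
  "fin_pseudo_orbit \<epsilon> g n \<xi> \<longleftrightarrow> (\<forall>j<n. dist (g (\<xi> j)) (\<xi> (Suc j)) \<le> \<epsilon>)"

definition pseudo_orbit :: "real \<Rightarrow> ('a::metric_space \<Rightarrow> 'a) \<Rightarrow> (nat \<Rightarrow> 'a) \<Rightarrow> bool" where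
  "pseudo_orbit \<epsilon> g \<xi> \<longleftrightarrow> (\<forall>j. dist (g (\<xi> j)) (\<xi> (Suc j)) \<le> \<epsilon>)"

definition shadows :: "real \<Rightarrow> (nat \<Rightarrow> 'a::metric_space) \<Rightarrow> (nat \<Rightarrow> 'a) \<Rightarrow> bool" where
  "shadows \<delta> x \<xi> \<longleftrightarrow> (\<forall>n. dist (x n) (\<xi> n) < \<delta>)"

definition shadowing_property :: "real \<Rightarrow> real \<Rightarrow> ('a::metric_space \<Rightarrow> 'a) \<Rightarrow> bool" where
  "shadowing_property \<delta> \<epsilon> g \<longleftrightarrow>
     (\<forall>\<xi>. pseudo_orbit \<epsilon> g \<xi> \<longrightarrow> (\<exists>x\<^sub>0. shadows \<delta> (\<lambda>n. (g ^^ n) x\<^sub>0) \<xi>))"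

definition rotation_set :: "(real^2 \<Rightarrow> real^2) \<Rightarrow> (real^2) set" where
  "rotation_set F = {v. \<exists>(n :: nat \<Rightarrow> nat) (x :: nat \<Rightarrow> real^2).
     incseq n \<and> filterlim n at_top sequentially \<and>
     (\<lambda>i. ((F ^^ n i) (x i) - x i) /\<^sub>R real (n i)) \<longlonglongrightarrow> v}"

definition accumulation_point :: "(nat \<Rightarrow> 'a::topological_space) \<Rightarrow> 'a \<Rightarrow> bool" where
  "accumulation_point s v \<longleftrightarrow> (\<forall>U. open U \<and> v \<in> U \<longrightarrow> infinite {i. s i \<in> U})"

definition eps_rotation_set :: "real \<Rightarrow> (real^2 \<Rightarrow> real^2) \<Rightarrow> (real^2) set" where
  "eps_rotation_set \<epsilon> F = {v. \<exists>(n :: nat \<Rightarrow> nat) (\<xi> :: nat \<Rightarrow> nat \<Rightarrow> real^2).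
     filterlim n at_top sequentially \<and>
     (\<forall>i. fin_pseudo_orbit \<epsilon> F (n i) (\<xi> i)) \<and>
     accumulation_point (\<lambda>i. (\<xi> i (n i) - \<xi> i 0) /\<^sub>R real (n i)) v}"

end

theory Submission
  imports Defs
begin

text \<open>
  Orbits are pseudo-orbits, so only \<open>eps_rotation_set \<epsilon> F \<subseteq> rotation_set F\<close> needs an argument.
  The point is that shadowing, which is assumed on the torus only, lifts to the plane. A
  pseudo-orbit \<open>\<xi>\<close> of \<open>F\<close> projects to a pseudo-orbit of \<open>f\<close>, which is \<open>\<delta>\<close>-shadowed by an orbit of
  \<open>f\<close>; lift that orbit to an orbit of \<open>F\<close> starting within \<open>\<delta>\<close> of \<open>\<xi> 0\<close>. At each time the lifted
  orbit is within \<open>\<delta>\<close> of \<^emph>\<open>some\<close> integer translate of \<open>\<xi> j\<close>, and the translate never changes: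
  if it is \<open>\<xi> j\<close> itself at time \<open>j\<close>, then the modulus of continuity of \<open>f\<close>, which \<open>F\<close> inherits
  (\<open>lift_inherits_modulus\<close>), puts the orbit within \<open>1/2 - \<gamma> + \<epsilon> < 1/2\<close> of \<open>\<xi> (Suc j)\<close> at the next
  time. It is also within \<open>\<delta> < 1/2\<close> of a translate of \<open>\<xi> (Suc j)\<close>, and distinct translates are
  at distance at least 1 (\<open>lattice_separation\<close>), so that translate is \<open>\<xi> (Suc j)\<close>
  (\<open>lift_shadows\<close>).

  Hence the displacement of each finite pseudo-orbit of \<open>F\<close> is within \<open>2\<delta>\<close> of the displacement
  of an orbit segment of the same length. Divided by the length, the error tends to 0, so both
  kinds of segments have the same limiting mean displacements.
\<close>

section \<open>Lifting closeness from the torus to the plane\<close>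

lemma lattice_separation:
  assumes "proj x = proj y" and "dist x y < 1"
  shows "x = y"
proof -
  have "(x - y) $ i = 0" for i
  proof (rule Ints_nonzero_abs_less1)
    show "(x - y) $ i \<in> \<int>"
      using assms(1) by (simp only: proj_eq_iff lattice_rel_def)
    have "\<bar>(x - y) $ i\<bar> \<le> dist x y"
      unfolding dist_norm by (rule component_le_norm_cart)
    then show "\<bar>(x - y) $ i\<bar> < 1"
      using assms(2) by linarith
  qed
  then show ?thesis
    by (simp add: vec_eq_iff)
qed

text \<open>
  The lift of \<open>proj b\<close> near \<open>a\<close> lies at distance less than 1 from \<open>b\<close>, hence is \<open>b\<close> itself. Thus
  a crude bound \<open>1/2\<close> in the plane is improved to the bound that holds on the torus.
\<close>

lemma dist_less_if_proj_dist_less: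
  assumes "dist (proj a) (proj b) < r" and "dist a b \<le> 1/2" and "r \<le> 1/2"
  shows "dist a b < r"
proof -
  obtain c where c: "proj c = proj b" "dist a c < r"
    using torus_dist_lessD[OF assms(1) refl] by blast
  have "dist c b \<le> dist a c + dist a b"
    by (rule dist_triangle3)
  also have "\<dots> < 1"
    using c(2) assms(2,3) by linarith
  finally have "c = b"
    using c(1) by (intro lattice_separation)
  with c(2) show ?thesis by simp
qed

lemma proj_lift:
  assumes "is_lift F f"
  shows "proj (F x) = f (proj x)"
  using assms unfolding is_lift_def by (metis comp_apply)

lemma proj_lift_funpow:
  assumes "is_lift F f"
  shows "proj ((F ^^ j) x) = (f ^^ j) (proj x)"
  by (induction j) (simp_all add: proj_lift[OF assms])

text \<open>
  A priori \<open>F\<close> could send nearby points close to two different translates. Moving one point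
  along the segment to the other excludes this: the distance of the images varies continuously
  from 0 and cannot take the value \<open>r\<close>, since \<open>r \<le> 1/2\<close> and the projected images are less than
  \<open>r\<close> apart (\<open>dist_less_if_proj_dist_less\<close>).
\<close>

lemma lift_inherits_modulus:
  assumes lift: "is_lift F f"
    and modulus: "\<And>x y. dist x y < \<delta> \<Longrightarrow> dist (f x) (f y) < r"
    and r: "0 < r" "r \<le> 1/2"
    and ab: "dist a b < \<delta>"
  shows "dist (F a) (F b) < r"
proof (rule ccontr)
  assume far: "\<not> dist (F a) (F b) < r"
  define p where "p t = a + t *\<^sub>R (b - a)" for t :: real
  define h where "h t = dist (F a) (F (p t))" for t
  have "continuous_on {0..1} p"
    unfolding p_def by (intro continuous_intros)
  then have "continuous_on {0..1} (\<lambda>t. F (p t))"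
    using lift unfolding is_lift_def by (blast intro: continuous_on_compose2)
  then have "continuous_on {0..1} h"
    unfolding h_def by (intro continuous_intros)
  moreover have "h 0 \<le> r" and "r \<le> h 1"
    using far r(1) by (simp_all add: h_def p_def)
  ultimately obtain t where t: "0 \<le> t" "t \<le> 1" "h t = r"
    using IVT'[of h 0 r 1] by auto
  have "dist a (p t) = t * dist a b"
    using t(1) by (simp add: p_def dist_norm norm_minus_commute)
  also have "\<dots> \<le> dist a b"
    using t(1,2) by (simp add: mult_left_le_one_le)
  finally have "dist (proj a) (proj (p t)) < \<delta>"
    using torus_dist_le[of a "p t"] ab by linarith
  then have "dist (proj (F a)) (proj (F (p t))) < r"
    by (simp add: proj_lift[OF lift] modulus)
  then have "h t < r"
    using t(3) r(2) unfolding h_def by (intro dist_less_if_proj_dist_less) auto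
  with t(3) show False by simp
qed

section \<open>Lifting the shadowing property\<close>

text \<open>
  Only the starting point has to be chosen near \<open>\<xi> 0\<close>. Later, the step bound \<open>1/2 - \<gamma> + \<epsilon>\<close> would
  accumulate on its own; the shadowing on the torus resets the distance to \<open>\<delta>\<close> at each time.
\<close>

lemma lift_shadows:
  assumes lift: "is_lift F f"
    and modulus: "\<And>x y. dist x y < \<delta> \<Longrightarrow> dist (f x) (f y) < 1/2 - \<gamma>"
    and \<delta>: "0 < \<delta>" "\<delta> \<le> 1/2" and \<gamma>: "\<gamma> < 1/2" and \<epsilon>: "0 \<le> \<epsilon>" "\<epsilon> \<le> \<gamma>"
    and orbit: "pseudo_orbit \<epsilon> F \<xi>"
    and start: "dist x (\<xi> 0) < \<delta>"
    and shadow: "shadows \<delta> (\<lambda>j. (f ^^ j) (proj x)) (\<lambda>j. proj (\<xi> j))"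
  shows "shadows \<delta> (\<lambda>j. (F ^^ j) x) \<xi>"
proof -
  have "dist ((F ^^ j) x) (\<xi> j) < \<delta>" for j
  proof (induction j)
    case 0
    then show ?case using start by simp
  next
    case (Suc j)
    have "dist (F ((F ^^ j) x)) (F (\<xi> j)) < 1/2 - \<gamma>"
      using lift_inherits_modulus[OF lift modulus _ _ Suc] \<gamma> \<epsilon> by simp
    moreover have "dist (F (\<xi> j)) (\<xi> (Suc j)) \<le> \<epsilon>"
      using orbit by (simp add: pseudo_orbit_def)
    ultimately have "dist (F ((F ^^ j) x)) (\<xi> (Suc j)) \<le> 1/2"
      using dist_triangle[of "F ((F ^^ j) x)" "\<xi> (Suc j)" "F (\<xi> j)"] \<epsilon>(2) by linarith
    moreover have "dist (proj ((F ^^ Suc j) x)) (proj (\<xi> (Suc j))) < \<delta>"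
      using shadow by (simp only: shadows_def proj_lift_funpow[OF lift])
    ultimately show ?case
      using \<delta>(2) by (intro dist_less_if_proj_dist_less) simp_all
  qed
  then show ?thesis by (simp add: shadows_def)
qed

lemma pseudo_orbit_proj:
  assumes "is_lift F f" and "pseudo_orbit \<epsilon> F \<xi>"
  shows "pseudo_orbit \<epsilon> f (\<lambda>j. proj (\<xi> j))"
  unfolding pseudo_orbit_def
proof
  fix j
  have "dist (f (proj (\<xi> j))) (proj (\<xi> (Suc j))) \<le> dist (F (\<xi> j)) (\<xi> (Suc j))"
    using torus_dist_le by (simp only: proj_lift[OF assms(1), symmetric])
  also have "\<dots> \<le> \<epsilon>"
    using assms(2) by (simp add: pseudo_orbit_def)
  finally show "dist (f (proj (\<xi> j))) (proj (\<xi> (Suc j))) \<le> \<epsilon>" .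
qed

lemma shadowing_property_lift:
  assumes lift: "is_lift F f"
    and modulus: "\<And>x y. dist x y < \<delta> \<Longrightarrow> dist (f x) (f y) < 1/2 - \<gamma>"
    and const: "0 < \<delta>" "\<delta> \<le> 1/2" "\<gamma> < 1/2" "0 \<le> \<epsilon>" "\<epsilon> \<le> \<gamma>"
    and shadowing: "shadowing_property \<delta> \<epsilon> f"
  shows "shadowing_property \<delta> \<epsilon> F"
  unfolding shadowing_property_def
proof (intro allI impI)
  fix \<xi> assume orbit: "pseudo_orbit \<epsilon> F \<xi>"
  obtain s where s: "shadows \<delta> (\<lambda>j. (f ^^ j) s) (\<lambda>j. proj (\<xi> j))"
    using shadowing pseudo_orbit_proj[OF lift orbit] unfolding shadowing_property_def by blast
  then have "dist ((f ^^ 0) s) (proj (\<xi> 0)) < \<delta>"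
    unfolding shadows_def by blast
  then have "dist (proj (\<xi> 0)) s < \<delta>"
    by (simp add: dist_commute)
  then obtain x where x: "proj x = s" "dist (\<xi> 0) x < \<delta>"
    using torus_dist_lessD[OF _ refl] by blast
  have "shadows \<delta> (\<lambda>j. (F ^^ j) x) \<xi>"
    using x s by (intro lift_shadows[OF lift modulus const orbit]) (simp_all add: dist_commute)
  then show "\<exists>x. shadows \<delta> (\<lambda>j. (F ^^ j) x) \<xi>" by blast
qed

section \<open>Finite pseudo-orbits and mean displacements\<close>

text \<open>
  Shadowing concerns infinite sequences; a finite pseudo-orbit falls under it because it can be
  continued by the true orbit of its last point.
\<close>

lemma shadowing_finite:
  assumes shadowing: "shadowing_property \<delta> \<epsilon> g" and "0 \<le> \<epsilon>"
    and orbit: "fin_pseudo_orbit \<epsilon> g n \<xi>"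
  shows "\<exists>x. \<forall>j\<le>n. dist ((g ^^ j) x) (\<xi> j) < \<delta>"
proof -
  define \<eta> where "\<eta> j = (if j \<le> n then \<xi> j else (g ^^ (j - n)) (\<xi> n))" for j
  have "dist (g (\<eta> j)) (\<eta> (Suc j)) \<le> \<epsilon>" for j
  proof (cases "j < n")
    case True
    then show ?thesis using orbit by (simp add: \<eta>_def fin_pseudo_orbit_def)
  next
    case False
    then have "\<eta> (Suc j) = g (\<eta> j)"
      by (auto simp: \<eta>_def Suc_diff_le)
    then show ?thesis using \<open>0 \<le> \<epsilon>\<close> by simp
  qed
  then have "pseudo_orbit \<epsilon> g \<eta>"
    by (simp add: pseudo_orbit_def)
  then obtain x where x: "dist ((g ^^ j) x) (\<eta> j) < \<delta>" for j
    using shadowing unfolding shadowing_property_def shadows_def by blast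
  have "dist ((g ^^ j) x) (\<xi> j) < \<delta>" if "j \<le> n" for j
    using x[of j] that by (simp add: \<eta>_def)
  then show ?thesis by blast
qed

lemma LIMSEQ_imp_accumulation_point:
  assumes "s \<longlonglongrightarrow> v"
  shows "accumulation_point s v"
  unfolding accumulation_point_def
proof (intro allI impI)
  fix U assume "open U \<and> v \<in> U"
  then have "eventually (\<lambda>i. s i \<in> U) sequentially"
    using assms by (auto simp: tendsto_def)
  then have "frequently (\<lambda>i. s i \<in> U) cofinite"
    by (auto simp: cofinite_eq_sequentially intro: eventually_frequently)
  then show "infinite {i. s i \<in> U}"
    by (simp add: frequently_cofinite)
qed

text \<open>
  The lengths in the definition of the rotation set must be nondecreasing, which those of the
  pseudo-orbits need not be; so the subsequence has to be thinned out along with \<open>n\<close>.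
\<close>

lemma accumulation_point_monotone_subsequence:
  fixes s :: "nat \<Rightarrow> 'a::metric_space" and n :: "nat \<Rightarrow> nat"
  assumes acc: "accumulation_point s v" and n: "filterlim n at_top sequentially"
  obtains r where "strict_mono r" "incseq (n \<circ> r)" "(s \<circ> r) \<longlonglongrightarrow> v"
proof -
  have ex: "\<exists>i>i\<^sub>0. N \<le> n i \<and> dist (s i) v < inverse (real (Suc k))" for i\<^sub>0 N k
  proof -
    have "infinite {i. s i \<in> ball v (inverse (real (Suc k)))}"
      using acc unfolding accumulation_point_def
      by (elim allE[of _ "ball v (inverse (real (Suc k)))"]) simp
    then have "frequently (\<lambda>i. s i \<in> ball v (inverse (real (Suc k)))) sequentially"
      unfolding cofinite_eq_sequentially[symmetric] frequently_cofinite .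
    moreover have "eventually (\<lambda>i. i > i\<^sub>0 \<and> N \<le> n i) sequentially"
      using n by (auto simp: filterlim_at_top eventually_conj_iff)
    ultimately have "frequently (\<lambda>i. (i > i\<^sub>0 \<and> N \<le> n i) \<and>
        s i \<in> ball v (inverse (real (Suc k)))) sequentially"
      by (rule frequently_eventually_conj)
    then show ?thesis
      by (auto dest!: frequently_ex simp: dist_commute)
  qed
  have "\<exists>r. \<forall>k. dist (s (r k)) v < inverse (real (Suc k)) \<and>
      r k < r (Suc k) \<and> n (r k) \<le> n (r (Suc k))"
    using ex by (intro dependent_nat_choice) blast+
  then obtain r where r: "\<And>k. dist (s (r k)) v < inverse (real (Suc k))"
      "\<And>k. r k < r (Suc k)" "\<And>k. n (r k) \<le> n (r (Suc k))"
    by blast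
  have "eventually (\<lambda>k. norm (dist (s (r k)) v) \<le> inverse (real (Suc k))) sequentially"
    using r(1) by (simp add: less_imp_le)
  then have "(\<lambda>k. dist (s (r k)) v) \<longlonglongrightarrow> 0"
    by (rule Lim_null_comparison) (rule LIMSEQ_inverse_real_of_nat)
  then have "(s \<circ> r) \<longlonglongrightarrow> v"
    unfolding o_def by (rule tendsto_dist_iff[THEN iffD2])
  with r(2,3) show ?thesis
    by (intro that) (simp_all add: strict_mono_Suc_iff incseq_Suc_iff)
qed

lemma rotation_set_subset_eps_rotation_set:
  assumes "0 \<le> \<epsilon>"
  shows "rotation_set F \<subseteq> eps_rotation_set \<epsilon> F"
proof
  fix v assume "v \<in> rotation_set F"
  then obtain n x where n: "filterlim n at_top sequentially"
    and lim: "(\<lambda>i. ((F ^^ n i) (x i) - x i) /\<^sub>R real (n i)) \<longlonglongrightarrow> v"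
    unfolding rotation_set_def by blast
  define \<xi> where "\<xi> i j = (F ^^ j) (x i)" for i j
  have "fin_pseudo_orbit \<epsilon> F (n i) (\<xi> i)" for i
    using assms by (simp add: fin_pseudo_orbit_def \<xi>_def)
  moreover have "accumulation_point (\<lambda>i. (\<xi> i (n i) - \<xi> i 0) /\<^sub>R real (n i)) v"
    using lim by (intro LIMSEQ_imp_accumulation_point) (simp add: \<xi>_def)
  ultimately show "v \<in> eps_rotation_set \<epsilon> F"
    using n unfolding eps_rotation_set_def by blast
qed

lemma eps_rotation_set_subset_rotation_set:
  assumes shadowing: "shadowing_property \<delta> \<epsilon> F" and "0 \<le> \<epsilon>"
  shows "eps_rotation_set \<epsilon> F \<subseteq> rotation_set F"
proof
  fix v assume "v \<in> eps_rotation_set \<epsilon> F"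
  then obtain n \<xi> where n: "filterlim n at_top sequentially"
    and orbit: "\<And>i. fin_pseudo_orbit \<epsilon> F (n i) (\<xi> i)"
    and acc: "accumulation_point (\<lambda>i. (\<xi> i (n i) - \<xi> i 0) /\<^sub>R real (n i)) v"
    unfolding eps_rotation_set_def by blast
  have "\<forall>i. \<exists>x. \<forall>j\<le>n i. dist ((F ^^ j) x) (\<xi> i j) < \<delta>"
    using shadowing_finite[OF shadowing \<open>0 \<le> \<epsilon>\<close> orbit] by blast
  from choice[OF this]
  obtain x where x: "\<And>i j. j \<le> n i \<Longrightarrow> dist ((F ^^ j) (x i)) (\<xi> i j) < \<delta>"
    by blast
  obtain r where r: "strict_mono r" "incseq (n \<circ> r)"
    and lim: "((\<lambda>i. (\<xi> i (n i) - \<xi> i 0) /\<^sub>R real (n i)) \<circ> r) \<longlonglongrightarrow> v"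
    using accumulation_point_monotone_subsequence[OF acc n] by blast
  have nr: "filterlim (n \<circ> r) at_top sequentially"
    using filterlim_compose[OF n filterlim_subseq[OF r(1)]] by (simp add: o_def)
  define e where "e i = ((F ^^ n i) (x i) - x i) - (\<xi> i (n i) - \<xi> i 0)" for i
  have "norm (e i) \<le> 2 * \<delta>" for i
  proof -
    have "e i = ((F ^^ n i) (x i) - \<xi> i (n i)) - (x i - \<xi> i 0)"
      by (simp add: e_def)
    then have "norm (e i) \<le> dist ((F ^^ n i) (x i)) (\<xi> i (n i)) + dist (x i) (\<xi> i 0)"
      unfolding dist_norm by (simp only: norm_triangle_ineq4)
    then show ?thesis
      using x[of "n i" i] x[of 0 i] by simp
  qed
  then have "norm (e i /\<^sub>R real (n i)) \<le> 2 * \<delta> * inverse (real (n i))" for i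
    unfolding norm_scaleR by (subst mult.commute) (simp add: mult_right_mono)
  then have bound: "eventually (\<lambda>k. norm (e (r k) /\<^sub>R real (n (r k)))
      \<le> 2 * \<delta> * inverse (real ((n \<circ> r) k))) sequentially"
    by (intro always_eventually allI) (simp only: o_apply)
  have "filterlim (\<lambda>k. real ((n \<circ> r) k)) at_top sequentially"
    by (rule filterlim_compose[OF filterlim_real_sequentially nr])
  then have "(\<lambda>k. 2 * \<delta> * inverse (real ((n \<circ> r) k))) \<longlonglongrightarrow> 0"
    by (intro tendsto_mult_right_zero tendsto_inverse_0_at_top)
  then have "(\<lambda>k. e (r k) /\<^sub>R real (n (r k))) \<longlonglongrightarrow> 0"
    by (rule Lim_null_comparison[OF bound])
  from tendsto_add[OF lim this]
  have "(\<lambda>k. ((F ^^ (n \<circ> r) k) ((x \<circ> r) k) - (x \<circ> r) k) /\<^sub>R real ((n \<circ> r) k)) \<longlonglongrightarrow> v"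
    by (simp add: e_def flip: scaleR_right_distrib)
  then show "v \<in> rotation_set F"
    using r(2) nr unfolding rotation_set_def by blast
qed

theorem theorem15:
  fixes f :: "torus \<Rightarrow> torus" and F :: "real^2 \<Rightarrow> real^2" and \<delta> \<gamma> \<epsilon> :: real
  assumes "homeo_homotopic_id f"
    and "F \<in> H2" and "is_lift F f"
    and "\<delta> \<in> {0<..<1/2}" and "\<gamma> \<in> {0<..<1/2}"
    and "\<And>x y. dist x y < \<delta> \<Longrightarrow> dist (f x) (f y) < 1/2 - \<gamma>"
    and "\<epsilon> \<in> {0<..<\<gamma>}"
    and "shadowing_property \<delta> \<epsilon> f"
  shows "eps_rotation_set \<epsilon> F = rotation_set F"
proof (rule equalityI)
  have "shadowing_property \<delta> \<epsilon> F"
    using assms(4,5,7,8) by (intro shadowing_property_lift[OF assms(3,6)]) auto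
  then show "eps_rotation_set \<epsilon> F \<subseteq> rotation_set F"
    using assms(7) by (intro eps_rotation_set_subset_rotation_set) auto
  show "rotation_set F \<subseteq> eps_rotation_set \<epsilon> F"
    using assms(7) by (intro rotation_set_subset_eps_rotation_set) simp
qed

end
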